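(* Let $Z$ and $Z'$ be two normal forms of $\widehat{\mathcal{SN}}_{\mathrm{nd}}$ with respective parameters $\mathbf p=(\lambda,a_1,a_2,c_1,c_2)\in\mathcal P$ and $\mathbf p'=(\lambda',a_1',a_2',c_1',c_2')\in\mathcal P$. Then $Z$ and $Z'$ are $\widehat{\mathrm{Diff}}_{\mathrm{fib}}$-conjugate (i.e. $\Phi_*(Z)=Z'$ for some $\Phi\in\widehat{\mathrm{Diff}}_{\mathrm{fib}}$) if and only if $\mathbf p\sim\mathbf p'$.
   Context: Coordinates on $\mathbb{C}^3$ are $(x,\mathbf y)=(x,y_1,y_2)$. $\widehat{\mathrm{Diff}}_{\mathrm{fib}}$ is the group of formal diffeomorphisms of $\mathbb{C}^3$ fixing the origin of the form $(x,\mathbf y)\mapsto(x,\phi(x,\mathbf y))$, acting on singular formal vector fields by $\Phi_*(Y)=(\mathrm D\Phi\cdot Y)\circ\Phi^{-1}$. The parameter space is $$\mathcal P=\left\{(\lambda,a_1,a_2,c_1,c_2)\in\mathbb{C}^*\times(\mathbb{C}^2\setminus\Delta)\times(v\,\mathbb{C}[[v]])^2\right\},\qquad \Delta=\{(a_1,a_2)\in\mathbb{C}^2: a_1+a_2\in\mathbb{Q}_{\le0}\}.$$ The normal form of $\widehat{\mathcal{SN}}_{\mathrm{nd}}$ with parameters $(\lambda,a_1,a_2,c_1,c_2)\in\mathcal P$ is the formal vector field $$x^2\frac{\partial}{\partial x}+\big(-\lambda+a_1x+c_1(v)\big)y_1\frac{\partial}{\partial y_1}+\big(\lambda+a_2x+c_2(v)\big)y_2\frac{\partial}{\partial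 y_2},\qquad v:=y_1y_2.$$ The group $\mathbb{C}^*\times\mathbb{Z}/2\mathbb{Z}$ acts on $\mathcal P$ by: for $\theta\in\mathbb{C}^*$, $\theta\cdot(\lambda,a_1,a_2,c_1,c_2)=(\lambda,a_1,a_2,c_1\circ\varphi_\theta,c_2\circ\varphi_\theta)$ with $\varphi_\theta:v\mapsto\theta v$; and the non-trivial element of $\mathbb{Z}/2\mathbb{Z}$ acts by $(\lambda,a_1,a_2,c_1,c_2)\mapsto(-\lambda,a_2,a_1,c_2,c_1)$. We write $\mathbf p\sim\mathbf p'$ if $\mathbf p,\mathbf p'$ are in the same orbit of this action. *)

theory Defs
  imports Complex_Main "HOL-Computational_Algebra.Formal_Power_Series"
begin

text \<open>
  The ring of formal power series in the variables \<open>x, y1, y2\<close> is rendered as the iterated ring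
  of univariate series, with \<open>x\<close> outermost and \<open>y2\<close> innermost: the coefficient of
  \<open>x^i * y1^j * y2^k\<close> in \<open>f\<close> is \<open>coef3 f i j k\<close>.
\<close>

type_synonym fps3 = "complex fps fps fps"

definition coef3 :: "fps3 \<Rightarrow> nat \<Rightarrow> nat \<Rightarrow> nat \<Rightarrow> complex" where
  "coef3 f i j k = fps_nth (fps_nth (fps_nth f i) j) k"

definition Abs3 :: "(nat \<Rightarrow> nat \<Rightarrow> nat \<Rightarrow> complex) \<Rightarrow> fps3" where
  "Abs3 F = Abs_fps (\<lambda>i. Abs_fps (\<lambda>j. Abs_fps (\<lambda>k. F i j k)))"

definition const3 :: "complex \<Rightarrow> fps3" where
  "const3 c = fps_const (fps_const (fps_const c))"

definition var_x :: fps3 where "var_x = fps_X"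
definition var_y1 :: fps3 where "var_y1 = fps_const fps_X"
definition var_y2 :: fps3 where "var_y2 = fps_const (fps_const fps_X)"

definition deriv_x :: "fps3 \<Rightarrow> fps3" where
  "deriv_x f = fps_deriv f"
definition deriv_y1 :: "fps3 \<Rightarrow> fps3" where
  "deriv_y1 f = Abs_fps (\<lambda>i. fps_deriv (fps_nth f i))"
definition deriv_y2 :: "fps3 \<Rightarrow> fps3" where
  "deriv_y2 f = Abs_fps (\<lambda>i. Abs_fps (\<lambda>j. fps_deriv (fps_nth (fps_nth f i) j)))"

text \<open>
  Substitution of series without constant term into a series in one or in three variables. A
  product of \<open>m\<close> such series has no terms of total degree below \<open>m\<close>, so only the exponents up
  to \<open>i + j + k\<close> contribute to the coefficient of \<open>x^i * y1^j * y2^k\<close>. The definitions are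
  meaningful only if the substituted series have constant term \<open>0\<close>.
\<close>

definition subst1 :: "complex fps \<Rightarrow> fps3 \<Rightarrow> fps3" where
  "subst1 c g = Abs3 (\<lambda>i j k. \<Sum>n\<le>i + j + k. fps_nth c n * coef3 (g ^ n) i j k)"

text \<open>Triples of series serve both as formal maps and as formal vector fields.\<close>

type_synonym triple3 = "fps3 \<times> fps3 \<times> fps3"

fun subst3 :: "fps3 \<Rightarrow> triple3 \<Rightarrow> fps3" where
  "subst3 f (g0, g1, g2) =
     Abs3 (\<lambda>i j k. \<Sum>a\<le>i + j + k. \<Sum>b\<le>i + j + k. \<Sum>c\<le>i + j + k.
       coef3 f a b c * coef3 (g0 ^ a * g1 ^ b * g2 ^ c) i j k)"

fun comp3 :: "triple3 \<Rightarrow> triple3 \<Rightarrow> triple3" where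
  "comp3 (f0, f1, f2) G = (subst3 f0 G, subst3 f1 G, subst3 f2 G)"

definition id3 :: triple3 where
  "id3 = (var_x, var_y1, var_y2)"

fun fixes_origin :: "triple3 \<Rightarrow> bool" where
  "fixes_origin (f0, f1, f2) \<longleftrightarrow> coef3 f0 0 0 0 = 0 \<and> coef3 f1 0 0 0 = 0 \<and> coef3 f2 0 0 0 = 0"

definition is_formal_inverse :: "triple3 \<Rightarrow> triple3 \<Rightarrow> bool" where
  "is_formal_inverse \<Phi> \<Psi> \<longleftrightarrow> fixes_origin \<Psi> \<and> comp3 \<Phi> \<Psi> = id3 \<and> comp3 \<Psi> \<Phi> = id3"

text \<open>The group of units of the monoid of formal maps fixing the origin.\<close>

definition Diff :: "triple3 set" where
  "Diff = {\<Phi>. fixes_origin \<Phi> \<and> (\<exists>\<Psi>. is_formal_inverse \<Phi> \<Psi>)}"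

definition Diff_fib :: "triple3 set" where
  "Diff_fib = {\<Phi> \<in> Diff. fst \<Phi> = var_x}"

definition formal_inv :: "triple3 \<Rightarrow> triple3" where
  "formal_inv \<Phi> = (THE \<Psi>. is_formal_inverse \<Phi> \<Psi>)"

text \<open>The vector field \<open>(Y0, Y1, Y2)\<close> is \<open>Y0 d/dx + Y1 d/dy1 + Y2 d/dy2\<close>.\<close>

fun apply_vf :: "triple3 \<Rightarrow> fps3 \<Rightarrow> fps3" where
  "apply_vf (Y0, Y1, Y2) f = deriv_x f * Y0 + deriv_y1 f * Y1 + deriv_y2 f * Y2"

fun jacobian_mult :: "triple3 \<Rightarrow> triple3 \<Rightarrow> triple3" where
  "jacobian_mult (f0, f1, f2) Y = (apply_vf Y f0, apply_vf Y f1, apply_vf Y f2)"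

definition pushforward :: "triple3 \<Rightarrow> triple3 \<Rightarrow> triple3" where
  "pushforward \<Phi> Y = comp3 (jacobian_mult \<Phi> Y) (formal_inv \<Phi>)"

definition fib_conjugate :: "triple3 \<Rightarrow> triple3 \<Rightarrow> bool" where
  "fib_conjugate Z Z' \<longleftrightarrow> (\<exists>\<Phi>\<in>Diff_fib. pushforward \<Phi> Z = Z')"

type_synonym param = "complex \<times> complex \<times> complex \<times> complex fps \<times> complex fps"

definition Delta :: "(complex \<times> complex) set" where
  "Delta = {(a1, a2). \<exists>q::rat. q \<le> 0 \<and> a1 + a2 = of_rat q}"

definition param_space :: "param set" where
  "param_space = {(l, a1, a2, c1, c2).
     l \<noteq> 0 \<and> (a1, a2) \<notin> Delta \<and> fps_nth c1 0 = 0 \<and> fps_nth c2 0 = 0}"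

fun normal_form :: "param \<Rightarrow> triple3" where
  "normal_form (l, a1, a2, c1, c2) =
     (let v = var_y1 * var_y2 in
       (var_x ^ 2,
        (- const3 l + const3 a1 * var_x + subst1 c1 v) * var_y1,
        (const3 l + const3 a2 * var_x + subst1 c2 v) * var_y2))"

fun scale_param :: "complex \<Rightarrow> param \<Rightarrow> param" where
  "scale_param \<theta> (l, a1, a2, c1, c2) =
     (l, a1, a2, fps_compose c1 (fps_const \<theta> * fps_X), fps_compose c2 (fps_const \<theta> * fps_X))"

fun swap_param :: "param \<Rightarrow> param" where
  "swap_param (l, a1, a2, c1, c2) = (- l, a2, a1, c2, c1)"

text \<open>
  The action of the product of the multiplicative group of the complex numbers with the group of
  two elements; the latter is represented by \<open>bool\<close>, with \<open>True\<close> the non-trivial element.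
\<close>

fun param_act :: "complex \<times> bool \<Rightarrow> param \<Rightarrow> param" where
  "param_act (\<theta>, s) p = (if s then swap_param (scale_param \<theta> p) else scale_param \<theta> p)"

lemma param_act_one: "param_act (1, False) p = p"
  by (cases p) simp

lemma param_act_mult:
  "param_act (\<theta>, s) (param_act (\<theta>', s') p) = param_act (\<theta> * \<theta>', s \<noteq> s') p"
proof -
  have "fps_compose (fps_compose c (fps_const \<theta>' * fps_X)) (fps_const \<theta> * fps_X)
      = fps_compose c (fps_const (\<theta> * \<theta>') * fps_X)" for c :: "complex fps"
    unfolding fps_compose_linear by (simp add: fps_eq_iff power_mult_distrib mult_ac)
  then show ?thesis
    by (cases p) (auto simp del: fps_const_mult)
qed

definition param_orbit :: "param \<Rightarrow> param set" where
  "param_orbit p = {param_act (\<theta>, s) p |\<theta> s. \<theta> \<noteq> 0}"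

definition param_equiv :: "param \<Rightarrow> param \<Rightarrow> bool" where
  "param_equiv p p' \<longleftrightarrow> p' \<in> param_orbit p"

end

(*
  A conjugacy (x, f1, f2) satisfies Z f1 = (-l' + a1' x + c1'(f1 f2)) f1 and the analogous equation
  for f2. Compare coefficients by increasing degree in y1, y2 and then by increasing power of x.
  In degree 0 this gives f1 = f2 = 0, in degree 1 it gives l' = l or l' = -l and, up to exchanging
  f1 and f2, that a_i' = a_i and that the linear parts are A y1 and B y2. In higher degree all
  monomials of f1 and f2 except y1 v^n and y2 v^n are excluded since l is nonzero; the coefficient
  of x^m y1 v^n or x^m y2 v^n is multiplied by m + n (a1 + a2), which is nonzero as (a1, a2) is not
  in Delta, and at x = 0 the equation says that c_i'(A B v) and c_i(v) agree in degree n. Hence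
  every conjugacy is (x, A y1, B y2) or its exchange.
*)

theory Submission
  imports Defs
begin

declare One_nat_def [simp del]

section \<open>Coefficients and monomials of series in x, y1, y2\<close>

lemma fps3_eqI: "(\<And>i j k. coef3 f i j k = coef3 g i j k) \<Longrightarrow> f = g"
  by (simp add: fps_eq_iff coef3_def)

lemma coef3_Abs3 [simp]: "coef3 (Abs3 F) i j k = F i j k"
  by (simp add: coef3_def Abs3_def)

lemma coef3_add [simp]: "coef3 (f + g) i j k = coef3 f i j k + coef3 g i j k"
  and coef3_diff [simp]: "coef3 (f - g) i j k = coef3 f i j k - coef3 g i j k"
  and coef3_minus [simp]: "coef3 (- f) i j k = - coef3 f i j k"
  and coef3_0 [simp]: "coef3 0 i j k = 0"
  by (simp_all add: coef3_def)

lemma coef3_sum: "coef3 (sum f A) i j k = (\<Sum>a\<in>A. coef3 (f a) i j k)"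
  by (induction A rule: infinite_finite_induct) simp_all

lemma coef3_mult:
  "coef3 (f * g) i j k =
     (\<Sum>a\<le>i. \<Sum>b\<le>j. \<Sum>c\<le>k. coef3 f a b c * coef3 g (i - a) (j - b) (k - c))"
  by (simp add: coef3_def fps_mult_nth fps_sum_nth atLeast0AtMost)

lemma coef3_const3_mult [simp]: "coef3 (const3 r * f) i j k = r * coef3 f i j k"
  by (simp add: coef3_def const3_def)

lemma coef3_var_x_mult:
  "coef3 (var_x * f) i j k = (if i = 0 then 0 else coef3 f (i - 1) j k)"
  by (simp add: coef3_def var_x_def)

lemma const3_0 [simp]: "const3 0 = 0" and const3_1 [simp]: "const3 1 = 1"
  and const3_minus: "const3 (- r) = - const3 r"
  and const3_diff: "const3 (r - s) = const3 r - const3 s"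
  and const3_add: "const3 (r + s) = const3 r + const3 s"
  and const3_mult: "const3 (r * s) = const3 r * const3 s"
  by (simp_all add: const3_def)

lemma const3_power: "const3 (r ^ n) = const3 r ^ n"
  by (simp add: const3_def fps_const_power)

definition mono3 :: "nat \<Rightarrow> nat \<Rightarrow> nat \<Rightarrow> fps3" where
  "mono3 a b c = var_x ^ a * var_y1 ^ b * var_y2 ^ c"

lemma coef3_mono3: "coef3 (mono3 a b c) i j k = (if i = a \<and> j = b \<and> k = c then 1 else 0)"
  by (simp add: coef3_def mono3_def var_x_def var_y1_def var_y2_def fps_const_power
      fps_X_power_nth del: fps_const_mult)

lemma sum3_delta:
  fixes h :: "nat \<Rightarrow> nat \<Rightarrow> nat \<Rightarrow> complex"
  assumes "finite A" "finite B" "finite C"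
  shows "(\<Sum>a\<in>A. \<Sum>b\<in>B. \<Sum>c\<in>C. if a = i \<and> b = j \<and> c = k then h a b c else 0) =
    (if i \<in> A \<and> j \<in> B \<and> k \<in> C then h i j k else 0)"
proof -
  have "(\<Sum>a\<in>A. \<Sum>b\<in>B. \<Sum>c\<in>C. if a = i \<and> b = j \<and> c = k then h a b c else 0) =
      (\<Sum>p\<in>A \<times> B \<times> C. if p = (i, j, k) then h i j k else 0)"
    unfolding sum.cartesian_product by (rule sum.cong) (simp_all split: prod.split)
  then show ?thesis using assms by (simp add: sum.delta)
qed

lemma sum3_delta':
  fixes h :: "nat \<Rightarrow> nat \<Rightarrow> nat \<Rightarrow> complex"
  assumes "finite A" "finite B" "finite C"
  shows "(\<Sum>a\<in>A. \<Sum>b\<in>B. \<Sum>c\<in>C. if i = a \<and> j = b \<and> k = c then h a b c else 0) =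
    (if i \<in> A \<and> j \<in> B \<and> k \<in> C then h i j k else 0)"
  using sum3_delta[OF assms, of i j k h] by (simp add: eq_commute)

lemma mono3_mult: "mono3 a b c * mono3 a' b' c' = mono3 (a + a') (b + b') (c + c')"
  by (simp add: mono3_def power_add mult_ac)

lemma mono3_power: "mono3 a b c ^ n = mono3 (n * a) (n * b) (n * c)"
  by (simp add: mono3_def power_mult_distrib power_mult[symmetric] mult.commute)

lemma var_x_mono3: "var_x = mono3 1 0 0" and var_y1_mono3: "var_y1 = mono3 0 1 0"
  and var_y2_mono3: "var_y2 = mono3 0 0 1" and one_mono3: "1 = mono3 0 0 0"
  by (simp_all add: mono3_def)

section \<open>Orders of vanishing\<close>

text \<open>The weight of \<open>x\<close> is \<open>e\<close>, which is \<open>1\<close> for the total degree and \<open>0\<close> for the degree in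
  \<open>y1, y2\<close> alone.\<close>

definition vanishes_below :: "nat \<Rightarrow> nat \<Rightarrow> fps3 \<Rightarrow> bool" where
  "vanishes_below e N f \<longleftrightarrow> (\<forall>i j k. e * i + j + k < N \<longrightarrow> coef3 f i j k = 0)"

lemma vanishes_belowI:
  "(\<And>i j k. e * i + j + k < N \<Longrightarrow> coef3 f i j k = 0) \<Longrightarrow> vanishes_below e N f"
  by (simp add: vanishes_below_def)

lemma vanishes_belowD: "vanishes_below e N f \<Longrightarrow> e * i + j + k < N \<Longrightarrow> coef3 f i j k = 0"
  by (simp add: vanishes_below_def)

lemma vanishes_below_0 [simp]: "vanishes_below e 0 f" "vanishes_below e N 0"
  by (simp_all add: vanishes_below_def)

lemma vanishes_below_mono: "vanishes_below e N f \<Longrightarrow> M \<le> N \<Longrightarrow> vanishes_below e M f"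
  by (auto simp: vanishes_below_def)

lemma vanishes_below_add:
  "vanishes_below e N f \<Longrightarrow> vanishes_below e N g \<Longrightarrow> vanishes_below e N (f + g)"
  by (simp add: vanishes_below_def)

text \<open>A nonzero term of the convolution needs both exponents to reach their bounds, and the
  weights of the two exponents add up to the weight of the product.\<close>

lemma vanishes_below_mult:
  assumes f: "vanishes_below e M f" and g: "vanishes_below e N g"
  shows "vanishes_below e (M + N) (f * g)"
proof (rule vanishes_belowI)
  fix i j k assume less: "e * i + j + k < M + N"
  have "coef3 f a b c * coef3 g (i - a) (j - b) (k - c) = 0" if "a \<le> i" "b \<le> j" "c \<le> k" for a b c
  proof (rule ccontr)
    assume "\<not> ?thesis"
    then have "\<not> e * a + b + c < M" "\<not> e * (i - a) + (j - b) + (k - c) < N"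
      using vanishes_belowD[OF f, of a b c] vanishes_belowD[OF g, of "i - a" "j - b" "k - c"]
      by auto
    moreover have "e * i = e * a + e * (i - a)"
      by (metis add_mult_distrib2 le_add_diff_inverse that(1))
    ultimately show False using less that by linarith
  qed
  then show "coef3 (f * g) i j k = 0" unfolding coef3_mult by (intro sum.neutral ballI) simp
qed

lemma vanishes_below_mult_left: "vanishes_below e N g \<Longrightarrow> vanishes_below e N (f * g)"
  using vanishes_below_mult[of e 0 f N g] by simp

lemma vanishes_below_mult_right: "vanishes_below e N f \<Longrightarrow> vanishes_below e N (f * g)"
  using vanishes_below_mult[of e N f 0 g] by simp

lemma vanishes_below_power: "vanishes_below e N f \<Longrightarrow> vanishes_below e (n * N) (f ^ n)"
  by (induction n) (simp_all add: vanishes_below_mult)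

text \<open>\<open>f - g\<close> divides \<open>f ^ n - g ^ n\<close>.\<close>

lemma vanishes_below_power_diff:
  assumes "vanishes_below e N (f - g)" shows "vanishes_below e N (f ^ n - g ^ n)"
  unfolding power_diff_sumr2 by (rule vanishes_below_mult_right[OF assms])

lemma vanishes_below_1_1: "vanishes_below 1 1 f \<longleftrightarrow> coef3 f 0 0 0 = 0"
  by (simp add: vanishes_below_def)

section \<open>Substitution\<close>

text \<open>Each coefficient of \<open>S f\<close> only depends on the polynomial truncation of \<open>f\<close> at its degree.\<close>

lemma additive_eqI:
  fixes S T :: "fps3 \<Rightarrow> fps3"
  assumes S: "\<And>f g. S (f + g) = S f + S g" and T: "\<And>f g. T (f + g) = T f + T g"
    and Sv: "\<And>N f. vanishes_below 1 N f \<Longrightarrow> vanishes_below 1 N (S f)"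
    and Tv: "\<And>N f. vanishes_below 1 N f \<Longrightarrow> vanishes_below 1 N (T f)"
    and mono: "\<And>r a b c. S (const3 r * mono3 a b c) = T (const3 r * mono3 a b c)"
  shows "S f = T f"
proof (rule fps3_eqI)
  fix i j k
  define N where "N = Suc (i + j + k)"
  define P where "P = (\<Sum>a<N. \<Sum>b<N. \<Sum>c<N. const3 (coef3 f a b c) * mono3 a b c)"
  have additive_sum: "R (sum h A) = (\<Sum>a\<in>A. R (h a))"
    if "\<And>f g. R (f + g) = R f + R g" for R :: "fps3 \<Rightarrow> fps3" and h and A :: "nat set"
  proof -
    have "R 0 = 0" using that[of 0 0] by simp
    then show ?thesis by (induction A rule: infinite_finite_induct) (simp_all add: that)
  qed
  have P: "S P = T P"
    unfolding P_def additive_sum[of S, OF S] additive_sum[of T, OF T] mono by (rule refl)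
  have "vanishes_below 1 N (f - P)"
  proof (rule vanishes_belowI)
    fix i j k assume "1 * i + j + k < N"
    then have "coef3 P i j k = coef3 f i j k"
      using sum3_delta'[of "{..<N}" "{..<N}" "{..<N}" i j k "coef3 f"]
      by (simp add: P_def coef3_sum coef3_mono3 if_distrib[of "(*) _"] cong: if_cong)
    then show "coef3 (f - P) i j k = 0" by simp
  qed
  then have "coef3 (S (f - P)) i j k = 0" "coef3 (T (f - P)) i j k = 0"
    using vanishes_belowD[OF Sv, of N _ i j k] vanishes_belowD[OF Tv, of N _ i j k]
    by (simp_all add: N_def)
  moreover have "S f = S P + S (f - P)" "T f = T P + T (f - P)"
    by (simp_all flip: S T)
  ultimately show "coef3 (S f) i j k = coef3 (T f) i j k" using P by simp
qed

lemma subst3_add: "subst3 (f + g) G = subst3 f G + subst3 g G"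
  by (cases G) (auto intro!: fps3_eqI simp: distrib_right sum.distrib)

lemma subst3_const_mult: "subst3 (const3 r * f) G = const3 r * subst3 f G"
  by (cases G) (auto intro!: fps3_eqI simp: sum_distrib_left mult.assoc)

text \<open>This makes the bounds of the sums in \<open>subst3\<close> harmless: exponents beyond
  the total degree of a coefficient cannot contribute to it.\<close>

lemma vanishes_below_monomial:
  assumes "fixes_origin (g0, g1, g2)"
  shows "vanishes_below 1 (a + b + c) (g0 ^ a * g1 ^ b * g2 ^ c)"
  using assms vanishes_below_power[of 1 1 g0 a] vanishes_below_power[of 1 1 g1 b]
    vanishes_below_power[of 1 1 g2 c]
  by (simp add: vanishes_below_1_1 vanishes_below_mult)

lemma vanishes_below_subst3:
  assumes "fixes_origin G" "vanishes_below 1 N f"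
  shows "vanishes_below 1 N (subst3 f G)"
proof -
  obtain g0 g1 g2 where G: "G = (g0, g1, g2)" by (cases G)
  have "coef3 f a b c * coef3 (g0 ^ a * g1 ^ b * g2 ^ c) i j k = 0" if "i + j + k < N" for i j k a b c
  proof (cases "a + b + c < N")
    case True
    then show ?thesis using vanishes_belowD[OF assms(2)] by simp
  next
    case False
    then show ?thesis
      using that vanishes_belowD[OF vanishes_below_monomial[OF assms(1)[unfolded G]], of i j k]
      by simp
  qed
  then show ?thesis
    by (intro vanishes_belowI) (simp add: G, intro sum.neutral ballI, simp)
qed

text \<open>If the truncation in \<open>subst3\<close> cuts off the exponent
  \<open>(a, b, c)\<close>, then \<open>a + b + c\<close> exceeds \<open>i + j + k\<close> and the
  right-hand coefficient is zero as well.\<close>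

lemma subst3_mono3:
  assumes "fixes_origin (g0, g1, g2)"
  shows "subst3 (mono3 a b c) (g0, g1, g2) = g0 ^ a * g1 ^ b * g2 ^ c"
proof (rule fps3_eqI)
  fix i j k
  show "coef3 (subst3 (mono3 a b c) (g0, g1, g2)) i j k = coef3 (g0 ^ a * g1 ^ b * g2 ^ c) i j k"
    using vanishes_belowD[OF vanishes_below_monomial[OF assms], of i j k a b c]
      sum3_delta[of "{..i + j + k}" "{..i + j + k}" "{..i + j + k}" a b c
        "\<lambda>a b c. coef3 (g0 ^ a * g1 ^ b * g2 ^ c) i j k"]
    by (auto simp: coef3_mono3 if_distribR if_distrib[of "\<lambda>x. x * _"] cong: if_cong)
qed

text \<open>Both sides are additive in each factor and respect orders of vanishing, so two uses of
  \<open>additive_eqI\<close> reduce the claim to monomials: first the right factor varies, then the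
  left.\<close>

lemma subst3_mult:
  assumes G: "fixes_origin G"
  shows "subst3 (f * g) G = subst3 f G * subst3 g G"
proof -
  obtain g0 g1 g2 where G': "G = (g0, g1, g2)" by (cases G)
  note [simp] = subst3_mono3[OF G[unfolded G']]
  note intros = vanishes_below_subst3[OF G[unfolded G']] vanishes_below_mult_right
    vanishes_below_mult_left
  have mono: "subst3 (mono3 a b c * f) (g0, g1, g2) =
      subst3 (mono3 a b c) (g0, g1, g2) * subst3 f (g0, g1, g2)"
    for a b c f
  proof (rule additive_eqI[where S = "\<lambda>f. subst3 (mono3 a b c * f) (g0, g1, g2)"])
    fix r a' b' c'
    have eq: "mono3 a b c * (const3 r * mono3 a' b' c') = const3 r * mono3 (a + a') (b + b') (c + c')"
      by (simp only: mono3_mult[symmetric] mult_ac)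
    show "subst3 (mono3 a b c * (const3 r * mono3 a' b' c')) (g0, g1, g2) =
        subst3 (mono3 a b c) (g0, g1, g2) * subst3 (const3 r * mono3 a' b' c') (g0, g1, g2)"
      unfolding eq by (simp add: subst3_const_mult power_add mult_ac del: subst3.simps)
  qed (auto simp: distrib_left subst3_add simp del: subst3.simps intro: intros)
  show ?thesis unfolding G'
  proof (rule additive_eqI[where S = "\<lambda>f. subst3 (f * g) (g0, g1, g2)"])
    fix r a b c
    show "subst3 (const3 r * mono3 a b c * g) (g0, g1, g2) =
        subst3 (const3 r * mono3 a b c) (g0, g1, g2) * subst3 g (g0, g1, g2)"
      using mono by (simp add: subst3_const_mult mult.assoc del: subst3.simps)
  qed (auto simp: distrib_right subst3_add simp del: subst3.simps intro: intros)
qed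

lemma subst3_1: "fixes_origin G \<Longrightarrow> subst3 1 G = 1"
  using subst3_mono3[of _ _ _ 0 0 0] by (cases G) (simp add: one_mono3 [symmetric] del: subst3.simps)

lemma subst3_const3: "fixes_origin G \<Longrightarrow> subst3 (const3 r) G = const3 r"
  using subst3_const_mult[of r 1 G] by (simp add: subst3_1)

lemma subst3_0: "subst3 0 G = 0"
  using subst3_const_mult[of 0 1 G] by simp

lemma subst3_minus: "subst3 (- f) G = - subst3 f G"
  using subst3_const_mult[of "- 1" f G] by (simp add: const3_minus)

lemma subst3_diff: "subst3 (f - g) G = subst3 f G - subst3 g G"
  using subst3_add[of f "- g" G] by (simp add: subst3_minus del: subst3.simps)

lemma subst3_power: "fixes_origin G \<Longrightarrow> subst3 (f ^ n) G = subst3 f G ^ n"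
  by (induction n) (simp_all add: subst3_1 subst3_mult)

lemma subst3_var:
  assumes "fixes_origin (g0, g1, g2)"
  shows "subst3 var_x (g0, g1, g2) = g0" "subst3 var_y1 (g0, g1, g2) = g1"
    "subst3 var_y2 (g0, g1, g2) = g2"
  by (simp_all add: var_x_mono3 var_y1_mono3 var_y2_mono3 subst3_mono3[OF assms] del: subst3.simps)

lemma comp3_id: "fixes_origin F \<Longrightarrow> comp3 id3 F = F"
  by (cases F) (simp add: id3_def subst3_var del: subst3.simps)

lemma fixes_origin_id3: "fixes_origin id3"
  by (simp add: id3_def var_x_mono3 var_y1_mono3 var_y2_mono3 coef3_mono3)

lemma fixes_origin_comp3: "fixes_origin F \<Longrightarrow> fixes_origin G \<Longrightarrow> fixes_origin (comp3 F G)"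
  using vanishes_below_subst3[of G 1]
  by (cases F) (simp add: vanishes_below_1_1 del: subst3.simps)

lemma subst3_comp3:
  assumes G: "fixes_origin G" and H: "fixes_origin H"
  shows "subst3 (subst3 f G) H = subst3 f (comp3 G H)"
proof (rule additive_eqI[where S = "\<lambda>f. subst3 (subst3 f G) H"])
  fix r a b c
  obtain g0 g1 g2 where G': "G = (g0, g1, g2)" by (cases G)
  have "fixes_origin (subst3 g0 H, subst3 g1 H, subst3 g2 H)"
    using fixes_origin_comp3[OF G H] by (simp add: G')
  then show "subst3 (subst3 (const3 r * mono3 a b c) G) H = subst3 (const3 r * mono3 a b c) (comp3 G H)"
    using G H unfolding G'
    by (simp add: subst3_const_mult subst3_mono3 subst3_mult subst3_power del: subst3.simps)
qed (use fixes_origin_comp3[OF G H] G H in \<open>auto simp: subst3_add intro: vanishes_below_subst3\<close>)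

lemma comp3_assoc:
  "fixes_origin G \<Longrightarrow> fixes_origin H \<Longrightarrow> comp3 (comp3 F G) H = comp3 F (comp3 G H)"
  by (cases F) (simp add: subst3_comp3)

lemma subst3_id3: "subst3 f id3 = f"
proof (rule additive_eqI[where S = "\<lambda>f. subst3 f id3" and T = "\<lambda>f. f"])
  fix r a b c
  show "subst3 (const3 r * mono3 a b c) id3 = const3 r * mono3 a b c"
    using fixes_origin_id3 unfolding id3_def
    by (simp add: subst3_const_mult subst3_mono3 del: subst3.simps) (simp add: mono3_def)
qed (auto simp: subst3_add fixes_origin_id3 intro: vanishes_below_subst3)

lemma comp3_id3: "comp3 F id3 = F"
  by (cases F) (simp add: subst3_id3)

text \<open>A univariate series is read as a series in x alone, so that the associativity of
  \<open>subst3\<close> becomes available for \<open>subst1\<close>.\<close>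

lemma subst1_conv_subst3:
  "subst1 c g = subst3 (Abs3 (\<lambda>i j k. if j = 0 \<and> k = 0 then fps_nth c i else 0)) (g, 0, 0)"
proof (rule fps3_eqI)
  fix i j k
  have "(\<Sum>a\<le>N. \<Sum>b\<le>N. \<Sum>c'\<le>N. (if b = 0 \<and> c' = 0 then fps_nth c a else 0) *
      coef3 (g ^ a * 0 ^ b * 0 ^ c') i j k) = (\<Sum>a\<le>N. fps_nth c a * coef3 (g ^ a) i j k)"
    for N :: nat
  proof (rule sum.cong)
    fix a
    show "(\<Sum>b\<le>N. \<Sum>c'\<le>N. (if b = 0 \<and> c' = 0 then fps_nth c a else 0) *
      coef3 (g ^ a * 0 ^ b * 0 ^ c') i j k) = fps_nth c a * coef3 (g ^ a) i j k"
      using sum3_delta[of "{a}" "{..N}" "{..N}" a 0 0 "\<lambda>_ _ _. fps_nth c a * coef3 (g ^ a) i j k"]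
      by (simp add: power_0_left if_distribR if_distrib[of "\<lambda>x. x * _"] cong: if_cong conj_cong)
  qed simp
  then show "coef3 (subst1 c g) i j k = coef3 (subst3 (Abs3 (\<lambda>i j k.
      if j = 0 \<and> k = 0 then fps_nth c i else 0)) (g, 0, 0)) i j k"
    by (simp add: subst1_def)
qed

lemma subst3_subst1:
  assumes "coef3 g 0 0 0 = 0" and G: "fixes_origin G"
  shows "subst3 (subst1 c g) G = subst1 c (subst3 g G)"
  using assms by (simp add: subst1_conv_subst3 subst3_comp3 subst3_0 del: subst3.simps)

lemma coef3_subst3_linear:
  assumes G: "fixes_origin (g0, g1, g2)" and ijk: "i + j + k = 1"
  shows "coef3 (subst3 f (g0, g1, g2)) i j k =
    coef3 f 1 0 0 * coef3 g0 i j k + coef3 f 0 1 0 * coef3 g1 i j k + coef3 f 0 0 1 * coef3 g2 i j k"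
proof -
  \<comment> \<open>In degree 1 the exponents in \<open>subst3\<close> run over 0 and 1; besides the
    constant and the three linear terms this leaves four products, all of order at least 2.\<close>
  have "coef3 (g0 ^ a * g1 ^ b * g2 ^ c) i j k = 0" if "2 \<le> a + b + c" for a b c
    using vanishes_belowD[OF vanishes_below_monomial[OF G], of i j k a b c] that ijk by simp
  from this[of 1 1 0] this[of 1 0 1] this[of 0 1 1] this[of 1 1 1]
  have "coef3 (g0 * g1) i j k = 0" "coef3 (g0 * g2) i j k = 0" "coef3 (g1 * g2) i j k = 0"
    "coef3 (g0 * g1 * g2) i j k = 0" by simp_all
  moreover have "coef3 1 i j k = 0" using ijk by (auto simp: one_mono3 coef3_mono3)
  moreover have "{..1::nat} = {0, 1}" by auto
  ultimately show ?thesis by (simp add: ijk)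
qed

lemma coef3_subst1_monomial:
  "coef3 (subst1 c (const3 t * mono3 0 1 1)) i j k =
     (if i = 0 \<and> j = k then fps_nth c j * t ^ j else 0)"
proof -
  have "(const3 t * mono3 0 1 1) ^ n = const3 (t ^ n) * mono3 0 n n" for n
    by (simp add: power_mult_distrib const3_power mono3_power)
  then have coef: "fps_nth c n * coef3 ((const3 t * mono3 0 1 1) ^ n) i j k =
      (if j = n then if i = 0 \<and> j = k then fps_nth c j * t ^ j else 0 else 0)" for n
    by (simp add: coef3_mono3)
  show ?thesis unfolding subst1_def coef3_Abs3 coef by simp
qed

lemma vanishes_below_subst1:
  assumes "fps_nth c 0 = 0" "vanishes_below e N g"
  shows "vanishes_below e N (subst1 c g)"
proof (rule vanishes_belowI)
  fix i j k assume less: "e * i + j + k < N"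
  have "fps_nth c n * coef3 (g ^ n) i j k = 0" for n
  proof (cases n)
    case (Suc m)
    then show ?thesis
      using vanishes_belowD[OF vanishes_below_mult_right[OF assms(2), of "g ^ m"] less] by simp
  qed (simp add: assms)
  then show "coef3 (subst1 c g) i j k = 0" unfolding subst1_def coef3_Abs3
    by (intro sum.neutral ballI)
qed

text \<open>Lets \<open>f1 * f2\<close> be replaced by its leading term inside the nonlinear part of
  a normal form.\<close>

lemma vanishes_below_subst1_diff:
  assumes "vanishes_below e N (g - h)"
  shows "vanishes_below e N (subst1 c g - subst1 c h)"
proof (rule vanishes_belowI)
  fix i j k assume "e * i + j + k < N"
  then have "coef3 (g ^ n) i j k = coef3 (h ^ n) i j k" for n
    using vanishes_belowD[OF vanishes_below_power_diff[OF assms]] by fastforce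
  then show "coef3 (subst1 c g - subst1 c h) i j k = 0" by (simp add: subst1_def)
qed

section \<open>The conjugacy equation\<close>

lemma formal_inv_eq:
  assumes "fixes_origin \<Phi>" "is_formal_inverse \<Phi> \<Psi>"
  shows "formal_inv \<Phi> = \<Psi>"
  unfolding formal_inv_def
proof (rule the_equality)
  fix \<Psi>' assume "is_formal_inverse \<Phi> \<Psi>'"
  then show "\<Psi>' = \<Psi>" using assms unfolding is_formal_inverse_def
    by (metis comp3_assoc comp3_id comp3_id3)
qed (fact assms(2))

text \<open>Composing with \<open>\<Phi>\<close> on the right removes the inverse and leaves an
  equation in the components of \<open>\<Phi>\<close> alone.\<close>

lemma pushforward_eq_iff:
  assumes "\<Phi> \<in> Diff"
  shows "pushforward \<Phi> Y = Y' \<longleftrightarrow> jacobian_mult \<Phi> Y = comp3 Y' \<Phi>"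
proof -
  from assms obtain \<Psi> where "fixes_origin \<Phi>" "is_formal_inverse \<Phi> \<Psi>"
    by (auto simp: Diff_def)
  then show ?thesis
    unfolding pushforward_def formal_inv_eq[OF \<open>fixes_origin \<Phi>\<close> \<open>is_formal_inverse \<Phi> \<Psi>\<close>]
    unfolding is_formal_inverse_def
    by (metis comp3_assoc comp3_id3)
qed

lemma normal_form_comp3:
  assumes "fixes_origin (var_x, f1, f2)"
  shows "comp3 (normal_form (l, a1, a2, c1, c2)) (var_x, f1, f2) =
    (var_x ^ 2, (const3 (- l) + const3 a1 * var_x + subst1 c1 (f1 * f2)) * f1,
     (const3 l + const3 a2 * var_x + subst1 c2 (f1 * f2)) * f2)"
proof -
  have "coef3 (var_y1 * var_y2) 0 0 0 = 0"
    by (simp add: var_y1_mono3 var_y2_mono3 mono3_mult coef3_mono3)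
  then show ?thesis
    using assms
    by (simp add: Let_def subst3_mult subst3_add subst3_diff subst3_minus subst3_power
        subst3_subst1
        subst3_const3 subst3_var const3_minus del: subst3.simps)
qed

lemma apply_vf_var_x: "apply_vf (Y0, Y1, Y2) var_x = Y0"
proof -
  have "deriv_x var_x = 1" "deriv_y1 var_x = 0" "deriv_y2 var_x = 0"
    by (simp_all add: deriv_x_def deriv_y1_def deriv_y2_def var_x_def fps_eq_iff fps_X_def)
  then show ?thesis by simp
qed

text \<open>The x-component holds automatically, both sides being \<open>var_x ^ 2\<close>; two
  scalar equations remain.\<close>

lemma pushforward_normal_form_iff:
  assumes "(var_x, f1, f2) \<in> Diff"
  shows "pushforward (var_x, f1, f2) (normal_form (l, a1, a2, c1, c2)) =
      normal_form (l', a1', a2', c1', c2') \<longleftrightarrow>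
    apply_vf (normal_form (l, a1, a2, c1, c2)) f1 =
      (const3 (- l') + const3 a1' * var_x + subst1 c1' (f1 * f2)) * f1 \<and>
    apply_vf (normal_form (l, a1, a2, c1, c2)) f2 =
      (const3 l' + const3 a2' * var_x + subst1 c2' (f1 * f2)) * f2"
proof -
  have "fixes_origin (var_x, f1, f2)" using assms by (simp add: Diff_def)
  then show ?thesis
    unfolding pushforward_eq_iff[OF assms] normal_form_comp3[OF \<open>fixes_origin _\<close>]
    by (simp add: Let_def apply_vf_var_x del: apply_vf.simps)
qed

section \<open>Normal forms as derivations, coefficient by coefficient\<close>

lemma fps_nth_of_nat_mult: "fps_nth (of_nat n * f) i = of_nat n * fps_nth f i"
  for f :: "'a :: comm_ring_1 fps"
  by (simp flip: fps_of_nat)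

lemma coef3_deriv:
  "coef3 (deriv_x f) i j k = of_nat (i + 1) * coef3 f (i + 1) j k"
  "coef3 (deriv_y1 f) i j k = of_nat (j + 1) * coef3 f i (j + 1) k"
  "coef3 (deriv_y2 f) i j k = of_nat (k + 1) * coef3 f i j (k + 1)"
  by (simp_all only: coef3_def deriv_x_def deriv_y1_def deriv_y2_def fps_deriv_nth
      fps_nth_Abs_fps fps_nth_of_nat_mult)

lemma coef3_x_deriv: "coef3 (deriv_x f * var_x ^ 2) i j k =
    (if i = 0 then 0 else (of_nat i - 1) * coef3 f (i - 1) j k)"
proof -
  consider "i = 0" | "i = 1" | n where "i = Suc (Suc n)"
    by (metis One_nat_def nat.exhaust)
  moreover have "coef3 (deriv_x f * var_x ^ 2) i j k =
      (if i < 2 then 0 else coef3 (deriv_x f) (i - 2) j k)"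
    by (simp add: coef3_def var_x_def fps_X_power_mult_right_nth)
  ultimately show ?thesis
    by cases (simp_all add: coef3_deriv, simp add: Suc_eq_plus1 add.commute)
qed

lemma coef3_y_deriv:
  "coef3 (deriv_y1 f * var_y1) i j k = of_nat j * coef3 f i j k"
  "coef3 (deriv_y2 f * var_y2) i j k = of_nat k * coef3 f i j k"
proof -
  have "coef3 (deriv_y1 f * var_y1) i j k = (if j = 0 then 0 else coef3 (deriv_y1 f) i (j - 1) k)"
    "coef3 (deriv_y2 f * var_y2) i j k = (if k = 0 then 0 else coef3 (deriv_y2 f) i j (k - 1))"
    by (simp_all add: coef3_def var_y1_def var_y2_def)
  then show "coef3 (deriv_y1 f * var_y1) i j k = of_nat j * coef3 f i j k"
    "coef3 (deriv_y2 f * var_y2) i j k = of_nat k * coef3 f i j k"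
    by (simp_all add: coef3_deriv del: of_nat_add of_nat_Suc)
qed

lemma apply_normal_form:
  "apply_vf (normal_form (l, a1, a2, c1, c2)) f = deriv_x f * var_x ^ 2 +
    (const3 (- l) + const3 a1 * var_x + subst1 c1 (mono3 0 1 1)) * (deriv_y1 f * var_y1) +
    (const3 l + const3 a2 * var_x + subst1 c2 (mono3 0 1 1)) * (deriv_y2 f * var_y2)"
  by (simp add: Let_def var_y1_mono3 var_y2_mono3 mono3_mult const3_minus mult_ac)

lemma vanishes_below_y_deriv:
  "vanishes_below e N f \<Longrightarrow> vanishes_below e N (deriv_y1 f * var_y1)"
  "vanishes_below e N f \<Longrightarrow> vanishes_below e N (deriv_y2 f * var_y2)"
  by (simp_all add: vanishes_below_def coef3_y_deriv)

text \<open>The nonlinear terms raise the degree in y1, y2. In the lowest degree of \<open>f\<close>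
  only two effects remain: the eigenvalue of the monomial and a shift by one power of x.\<close>

lemma coef3_apply_normal_form:
  assumes "fps_nth c1 0 = 0" "fps_nth c2 0 = 0" and f: "vanishes_below 0 (j + k) f"
  shows "coef3 (apply_vf (normal_form (l, a1, a2, c1, c2)) f) i j k =
    l * (of_nat k - of_nat j) * coef3 f i j k +
    (if i = 0 then 0 else (of_nat i - 1 + a1 * of_nat j + a2 * of_nat k) * coef3 f (i - 1) j k)"
proof -
  have "vanishes_below 0 1 (mono3 0 1 1)" by (simp add: vanishes_below_def coef3_mono3)
  then have "vanishes_below 0 (1 + (j + k)) (subst1 c1 (mono3 0 1 1) * (deriv_y1 f * var_y1))"
    "vanishes_below 0 (1 + (j + k)) (subst1 c2 (mono3 0 1 1) * (deriv_y2 f * var_y2))"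
    by (intro vanishes_below_mult vanishes_below_subst1 vanishes_below_y_deriv assms; simp)+
  then have "coef3 (subst1 c1 (mono3 0 1 1) * (deriv_y1 f * var_y1)) i j k = 0"
    "coef3 (subst1 c2 (mono3 0 1 1) * (deriv_y2 f * var_y2)) i j k = 0"
    by (simp_all add: vanishes_below_def)
  then show ?thesis
    unfolding apply_normal_form
    by (simp add: distrib_right mult.assoc coef3_x_deriv coef3_y_deriv coef3_var_x_mult)
      (simp add: algebra_simps)
qed

text \<open>Monomials in y1, y2 are multiplied by a cofactor. This serves both to subtract the
  leading term of a solution and to verify the explicit conjugacies.\<close>

lemma apply_normal_form_monomial:
  "apply_vf (normal_form (l, a1, a2, c1, c2)) (const3 A * mono3 0 p q) =
    (const3 (l * (of_nat q - of_nat p)) + const3 (of_nat p * a1 + of_nat q * a2) * var_x +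
     const3 (of_nat p) * subst1 c1 (mono3 0 1 1) + const3 (of_nat q) * subst1 c2 (mono3 0 1 1)) *
    (const3 A * mono3 0 p q)" (is "_ = _ * ?M")
proof -
  have "deriv_x ?M * var_x ^ 2 = 0"
    by (rule fps3_eqI) (simp add: coef3_x_deriv coef3_mono3)
  moreover have "deriv_y1 ?M * var_y1 = const3 (of_nat p) * ?M"
    "deriv_y2 ?M * var_y2 = const3 (of_nat q) * ?M"
    by (rule fps3_eqI; simp add: coef3_y_deriv coef3_mono3)+
  ultimately show ?thesis
    unfolding apply_normal_form
    by (simp add: const3_add const3_diff const3_mult const3_minus algebra_simps)
qed

lemma apply_vf_diff: "apply_vf Y (f - g) = apply_vf Y f - apply_vf Y g"
proof -
  have "deriv_x (f - g) = deriv_x f - deriv_x g" "deriv_y1 (f - g) = deriv_y1 f - deriv_y1 g"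
    "deriv_y2 (f - g) = deriv_y2 f - deriv_y2 g"
    by (rule fps3_eqI; simp add: coef3_deriv right_diff_distrib)+
  then show ?thesis by (cases Y) (simp only: apply_vf.simps left_diff_distrib, simp)
qed

section \<open>Rigidity of the solutions\<close>

text \<open>On the axis y1 = y2 = 0 the equation expresses \<open>m\<close> times the coefficient of
  \<open>x^i\<close> through earlier coefficients, so all vanish by induction.\<close>

lemma solution_vanishes_on_x_axis:
  assumes eq: "apply_vf (normal_form (l, a1, a2, c1, c2)) f =
      (const3 m + const3 b * var_x + subst1 d w) * f"
    and c: "fps_nth c1 0 = 0" "fps_nth c2 0 = 0" and d: "fps_nth d 0 = 0" and m: "m \<noteq> 0"
  shows "vanishes_below 0 1 f"
proof -
  have "coef3 f i 0 0 = 0" for i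
  proof (induction i rule: less_induct)
    case (less i)
    \<comment> \<open>For \<open>a = 0\<close> the first factor is \<open>fps_nth d 0\<close>; for
      \<open>a > 0\<close> the induction hypothesis applies.\<close>
    have "coef3 (subst1 d w) a 0 0 * coef3 f (i - a) 0 0 = 0" if "a \<le> i" for a
      using less[of "i - a"] that d by (cases "a = 0") (simp_all add: subst1_def)
    then have "coef3 (subst1 d w * f) i 0 0 = 0"
      by (simp add: coef3_mult del: mult_eq_0_iff)
    moreover have "coef3 f (i - 1) 0 0 = 0" if "i \<noteq> 0" using less[of "i - 1"] that by simp
    ultimately show ?case
      using arg_cong[OF eq, of "\<lambda>f. coef3 f i 0 0"] m
      by (simp add: coef3_apply_normal_form[OF c] distrib_right mult.assoc coef3_var_x_mult
          split: if_splits del: apply_vf.simps normal_form.simps)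
  qed
  then show ?thesis by (simp add: vanishes_below_def)
qed

text \<open>The recursion in the power of x behind all later steps; \<open>D * f\<close> starts one
  degree in y1, y2 too late to contribute. The source \<open>r\<close> is there for the difference
  of a solution and its leading term.\<close>

lemma coef3_solution:
  assumes eq: "apply_vf (normal_form (l, a1, a2, c1, c2)) f =
      (const3 m + const3 b * var_x + D) * f + r"
    and c: "fps_nth c1 0 = 0" "fps_nth c2 0 = 0"
    and D: "vanishes_below 0 1 D" and f: "vanishes_below 0 (j + k) f"
  shows "(l * (of_nat k - of_nat j) - m) * coef3 f i j k +
    (if i = 0 then 0
     else (of_nat i - 1 + a1 * of_nat j + a2 * of_nat k - b) * coef3 f (i - 1) j k) = coef3 r i j k"
proof -
  have "coef3 (D * f) i j k = 0"
    using vanishes_belowD[OF vanishes_below_mult[OF D f], of i j k] by simp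
  then show ?thesis
    using arg_cong[OF eq, of "\<lambda>f. coef3 f i j k"]
    by (simp add: coef3_apply_normal_form[OF c f] distrib_right mult.assoc coef3_var_x_mult
          split: if_splits del: apply_vf.simps normal_form.simps) (simp_all add: algebra_simps)
qed

text \<open>The pair \<open>(p, q)\<close> selects y1 or y2, so that one argument serves both
  components. On the selected monomial the eigenvalues cancel and the recursion constrains the
  previous power of x; on the other monomial they do not cancel.\<close>

lemma solution_linear_part:
  assumes eq: "apply_vf (normal_form (l, a1, a2, c1, c2)) f =
      (const3 (l * (of_nat q - of_nat p)) + const3 b * var_x + D) * f"
    and pq: "p + q = 1" and l: "l \<noteq> 0"
    and c: "fps_nth c1 0 = 0" "fps_nth c2 0 = 0"
    and D: "vanishes_below 0 1 D" and f: "vanishes_below 0 1 f"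
    and A: "coef3 f 0 p q \<noteq> 0"
  shows "b = of_nat p * a1 + of_nat q * a2"
    and "vanishes_below 0 2 (f - const3 (coef3 f 0 p q) * mono3 0 p q)"
proof -
  have eq': "(l * (of_nat k - of_nat j) - l * (of_nat q - of_nat p)) * coef3 f i j k +
    (if i = 0 then 0
     else (of_nat i - 1 + a1 * of_nat j + a2 * of_nat k - b) * coef3 f (i - 1) j k) = 0"
    if "j + k = 1" for i j k
    using coef3_solution[of l a1 a2 c1 c2 f _ b D 0, OF _ c D, of "l * (of_nat q - of_nat p)" j k i]
      eq f that by simp
  \<comment> \<open>At \<open>i = 1\<close> the eigenvalues cancel, and the nonzero coefficient then
    determines \<open>b\<close>.\<close>
  have "(of_nat p * a1 + of_nat q * a2 - b) * coef3 f 0 p q = 0"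
    using eq'[of p q 1] pq by (simp add: algebra_simps)
  then show b: "b = of_nat p * a1 + of_nat q * a2"
    using A by simp
  \<comment> \<open>With \<open>b\<close> known, index \<open>Suc i\<close> leaves
    \<open>of_nat i\<close> times the coefficient at \<open>i\<close>.\<close>
  have pos: "coef3 f i p q = 0" if "i \<noteq> 0" for i
    using eq'[of p q "Suc i"] pq that by (simp add: b algebra_simps)
  have pq': "p = 1 \<and> q = 0 \<or> p = 0 \<and> q = 1" using pq by auto
  \<comment> \<open>Here the eigenvalue factor is 2 l or -2 l, so each coefficient is a multiple of
    the previous one, and the first is zero.\<close>
  have other: "coef3 f i q p = 0" for i
  proof (induction i)
    case 0
    then show ?case using eq'[of q p 0] pq' l by auto
  next
    case (Suc i)
    then show ?case using eq'[of q p "Suc i"] pq' l by auto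
  qed
  show "vanishes_below 0 2 (f - const3 (coef3 f 0 p q) * mono3 0 p q)"
  proof (rule vanishes_belowI)
    fix i j k assume "0 * i + j + k < (2::nat)"
    then consider "j + k = 0" | "j = p" "k = q" | "j = q" "k = p" using pq' by fastforce
    then show "coef3 (f - const3 (coef3 f 0 p q) * mono3 0 p q) i j k = 0"
    proof cases
      case 1
      then show ?thesis using vanishes_belowD[OF f, of i j k] pq' by (auto simp: coef3_mono3)
    next
      case 2
      then show ?thesis using pos[of i] by (auto simp: coef3_mono3)
    next
      case 3
      moreover have "q \<noteq> p" using pq' by auto
      ultimately show ?thesis using other[of i] by (simp add: coef3_mono3)
    qed
  qed
qed

lemma coef3_mult_mono3:
  "coef3 (f * mono3 0 p q) i j k = (if p \<le> j \<and> q \<le> k then coef3 f i (j - p) (k - q) else 0)"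
proof -
  have "mono3 0 p q = fps_const (fps_X ^ p * fps_const (fps_X ^ q))"
    by (simp add: mono3_def var_y1_def var_y2_def fps_const_power)
  then show ?thesis
    by (auto simp: coef3_def mult.assoc[symmetric] fps_X_power_mult_right_nth)
qed

text \<open>The difference \<open>g\<close> of \<open>f\<close> and its leading term solves the same
  equation with a source that is a multiple of the leading term. The order assumed for
  \<open>w\<close> is one higher than that for \<open>f\<close>, which is what the product of two
  such components provides.\<close>

lemma solution_step:
  assumes eq: "apply_vf (normal_form (l, a1, a2, c1, c2)) f =
      (const3 (l * (of_nat q - of_nat p)) + const3 (of_nat p * a1 + of_nat q * a2) * var_x +
       subst1 d w) * f"
    and pq: "p + q = 1" and l: "l \<noteq> 0"
    and nonres: "\<And>m n. n \<noteq> 0 \<Longrightarrow> of_nat m + of_nat n * (a1 + a2) \<noteq> 0"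
    and c: "fps_nth c1 0 = 0" "fps_nth c2 0 = 0" and d: "fps_nth d 0 = 0"
    and A: "A \<noteq> 0" and s: "2 \<le> s"
    and f: "vanishes_below 0 s (f - const3 A * mono3 0 p q)"
    and w: "vanishes_below 0 (s + 1) (w - const3 t * mono3 0 1 1)"
  shows "vanishes_below 0 (s + 1) (f - const3 A * mono3 0 p q)"
    and "s = 2 * n + 1 \<Longrightarrow>
      fps_nth d n * t ^ n = of_nat p * fps_nth c1 n + of_nat q * fps_nth c2 n"
proof -
  define M where "M = const3 A * mono3 0 p q"
  define E where
    "E = const3 (of_nat p) * subst1 c1 (mono3 0 1 1) + const3 (of_nat q) * subst1 c2 (mono3 0 1 1)"
  define g where "g = f - M"
  \<comment> \<open>The defect of the relation to be shown in degree \<open>n\<close>; up to the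
    factor \<open>A\<close> it is the source at the monomial y1^p y2^q v^n.\<close>
  define \<delta> where "\<delta> n = fps_nth d n * t ^ n - (of_nat p * fps_nth c1 n + of_nat q * fps_nth c2 n)" for n
  let ?V = "const3 t * mono3 0 1 1"
  have w1: "vanishes_below 0 1 w"
  proof -
    have "vanishes_below 0 1 ((w - ?V) + ?V)"
      using vanishes_below_mono[OF w, of 1]
      by (intro vanishes_below_add vanishes_below_mult_left)
        (simp_all add: vanishes_below_def coef3_mono3)
    then show ?thesis by simp
  qed
  have g: "vanishes_below 0 s g" using f by (simp add: g_def M_def)
  have "apply_vf (normal_form (l, a1, a2, c1, c2)) g =
      (const3 (l * (of_nat q - of_nat p)) + const3 (of_nat p * a1 + of_nat q * a2) * var_x +
       subst1 d w) * g + (subst1 d w - E) * M"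
    unfolding g_def apply_vf_diff eq apply_normal_form_monomial[of l a1 a2 c1 c2 A p q, folded M_def]
    by (simp add: E_def algebra_simps)
  note sol = coef3_solution[OF this c vanishes_below_subst1[OF d w1], of j k i for i j k]
  \<comment> \<open>Replacing \<open>w\<close> by its leading term changes only degrees above
    \<open>s\<close>; what remains lives at x^0 on the monomials y1^p y2^q v^n.\<close>
  have r: "coef3 ((subst1 d w - E) * M) i j k =
      (if i = 0 \<and> p \<le> j \<and> q \<le> k \<and> j - p = k - q then A * \<delta> (j - p) else 0)"
    if "j + k = s" for i j k
  proof -
    have E: "E = const3 (of_nat p) * subst1 c1 (const3 1 * mono3 0 1 1) +
        const3 (of_nat q) * subst1 c2 (const3 1 * mono3 0 1 1)" by (simp add: E_def)
    have "coef3 ((subst1 d w - subst1 d ?V) * M) i j k = 0"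
      using that vanishes_belowD[OF vanishes_below_mult_right[OF vanishes_below_subst1_diff[OF w]]]
      by simp
    moreover have "(subst1 d w - E) * M =
        (subst1 d w - subst1 d ?V) * M + const3 A * ((subst1 d ?V - E) * mono3 0 p q)"
      by (simp add: M_def algebra_simps)
    ultimately show ?thesis
      by (simp add: coef3_mult_mono3 coef3_subst1_monomial \<delta>_def E del: const3_1)
  qed
  have pq': "p = 1 \<and> q = 0 \<or> p = 0 \<and> q = 1" using pq by auto
  \<comment> \<open>Resonant monomials: the eigenvalues cancel, so index 0 forces the source to
    vanish, and index \<open>Suc i\<close> has the factor \<open>i + n (a1 + a2)\<close>. Here
    \<open>n\<close> is nonzero because \<open>s\<close> is at least 2.\<close>
  have res: "\<delta> n = 0" "coef3 g i (p + n) (q + n) = 0" if "s = 2 * n + 1" for i n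
  proof -
    have ps: "(p + n) + (q + n) = s" using that pq by simp
    have lin: "l * (of_nat (q + n) - of_nat (p + n)) - l * (of_nat q - of_nat p) = 0"
      by (simp add: algebra_simps)
    show "\<delta> n = 0" using sol[of "p + n" "q + n" 0] r[OF ps, of 0] g A lin by (simp add: ps)
    have "vanishes_below 0 ((p + n) + (q + n)) g" using g by (simp only: ps)
    from sol[OF this, of "Suc i"] r[OF ps, of "Suc i"] lin
    have "(of_nat i + of_nat n * (a1 + a2)) * coef3 g i (p + n) (q + n) = 0"
      by (simp add: algebra_simps)
    then show "coef3 g i (p + n) (q + n) = 0" using nonres[of n i] that s by auto
  qed
  show "fps_nth d n * t ^ n = of_nat p * fps_nth c1 n + of_nat q * fps_nth c2 n"
    if "s = 2 * n + 1"
    using res(1)[OF that] by (simp add: \<delta>_def)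
  \<comment> \<open>Nonresonant monomials have no source and a nonzero eigenvalue difference, so
    their coefficients vanish by induction on the power of x.\<close>
  have nonres_coef: "coef3 g i j k = 0" if jk: "j + k = s" "j + q \<noteq> k + p" for i j k
  proof -
    have "of_nat k - of_nat j \<noteq> (of_nat q - of_nat p :: complex)"
    proof
      assume "of_nat k - of_nat j = (of_nat q - of_nat p :: complex)"
      then have "of_nat (j + q) = (of_nat (k + p) :: complex)" by (simp add: algebra_simps)
      then show False using jk by (simp only: of_nat_eq_iff)
    qed
    then have lin: "l * (of_nat k - of_nat j) - l * (of_nat q - of_nat p) \<noteq> 0" using l by simp
    have r0: "coef3 ((subst1 d w - E) * M) i j k = 0" for i
      using r[OF jk(1), of i] jk(2) by auto
    show ?thesis
    proof (induction i)
      case 0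
      then show ?case using sol[of j k 0] g jk(1) lin r0 by simp
    next
      case (Suc i)
      then show ?case using sol[of j k "Suc i"] g jk(1) lin r0 by simp
    qed
  qed
  have "coef3 g i j k = 0" if "j + k < s + 1" for i j k
  proof (cases "j + k < s")
    case True
    then show ?thesis using vanishes_belowD[OF g, of i j k] by simp
  next
    case False
    with that have jk: "j + k = s" by simp
    show ?thesis
    proof (cases "j + q = k + p")
      case True
      \<comment> \<open>The relation gives \<open>p \<le> j\<close>, so the subtraction is exact and
        the monomial is resonant with \<open>n = j - p\<close>.\<close>
      then have "s = 2 * (j - p) + 1" "j = p + (j - p)" "k = q + (j - p)"
        using jk pq' s by auto
      then show ?thesis using res(2)[of "j - p" i] by metis
    qed (use nonres_coef jk in blast)
  qed
  then show "vanishes_below 0 (s + 1) (f - const3 A * mono3 0 p q)"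
    by (simp add: vanishes_below_def g_def M_def)
qed

text \<open>A zero would make \<open>a1 + a2\<close> equal to \<open>- m / n\<close>, a nonpositive
  rational number, which \<open>Delta\<close> excludes.\<close>

lemma nonresonant:
  assumes "(a1, a2) \<notin> Delta" "n \<noteq> 0"
  shows "of_nat m + of_nat n * (a1 + a2) \<noteq> 0"
proof
  assume "of_nat m + of_nat n * (a1 + a2) = 0"
  then have "a1 + a2 = of_rat (- of_nat m / of_nat n)"
    using assms(2) by (simp add: field_simps of_rat_divide of_rat_minus add_eq_0_iff)
  moreover have "- of_nat m / of_nat n \<le> (0 :: rat)" by simp
  ultimately show False using assms(1) by (auto simp: Delta_def)
qed

text \<open>Both components are improved together, one degree at a time, since each step needs the
  product \<open>f1 * f2\<close>. The scale \<open>t\<close> is \<open>A * B\<close>, the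
  coefficient of v in that product.\<close>

lemma conjugacy_same_sign:
  assumes eq1: "apply_vf (normal_form (l, a1, a2, c1, c2)) f1 =
      (const3 (- l) + const3 a1' * var_x + subst1 c1' (f1 * f2)) * f1"
    and eq2: "apply_vf (normal_form (l, a1, a2, c1, c2)) f2 =
      (const3 l + const3 a2' * var_x + subst1 c2' (f1 * f2)) * f2"
    and l: "l \<noteq> 0" and a: "(a1, a2) \<notin> Delta"
    and c: "fps_nth c1 0 = 0" "fps_nth c2 0 = 0" and c': "fps_nth c1' 0 = 0" "fps_nth c2' 0 = 0"
    and lin: "coef3 f1 0 1 0 \<noteq> 0" "coef3 f2 0 0 1 \<noteq> 0"
  obtains t where "t \<noteq> 0" "a1' = a1" "a2' = a2"
    "\<And>n. fps_nth c1' n * t ^ n = fps_nth c1 n" "\<And>n. fps_nth c2' n * t ^ n = fps_nth c2 n"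
proof -
  define A where "A = coef3 f1 0 1 0"
  define B where "B = coef3 f2 0 0 1"
  have f: "vanishes_below 0 1 f1" "vanishes_below 0 1 f2"
    using solution_vanishes_on_x_axis[OF eq1 c c'(1)] solution_vanishes_on_x_axis[OF eq2 c c'(2)] l
    by auto
  note D = vanishes_below_subst1[OF c'(1) vanishes_below_mult_right[OF f(1), of f2]]
    vanishes_below_subst1[OF c'(2) vanishes_below_mult_right[OF f(1), of f2]]
  have "a1' = a1" and f1: "vanishes_below 0 2 (f1 - const3 A * mono3 0 1 0)"
    using solution_linear_part[where p = 1 and q = 0, OF _ _ l c D(1) f(1), of a1 a2 a1'] eq1 lin(1)
    by (simp_all add: A_def)
  have "a2' = a2" and f2: "vanishes_below 0 2 (f2 - const3 B * mono3 0 0 1)"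
    using solution_linear_part[where p = 0 and q = 1, OF _ _ l c D(2) f(2), of a1 a2 a2'] eq2 lin(2)
    by (simp_all add: B_def)
  \<comment> \<open>The product gains a degree because \<open>f2\<close> and the monomial y1 both
    vanish on the x-axis.\<close>
  have W: "vanishes_below 0 (s + 1) (f1 * f2 - const3 (A * B) * mono3 0 1 1)"
    if "vanishes_below 0 s (f1 - const3 A * mono3 0 1 0)"
      "vanishes_below 0 s (f2 - const3 B * mono3 0 0 1)" for s
  proof -
    have "f1 * f2 - const3 (A * B) * mono3 0 1 1 = (f1 - const3 A * mono3 0 1 0) * f2 +
        const3 A * (mono3 0 1 0 * (f2 - const3 B * mono3 0 0 1))"
      by (simp add: algebra_simps const3_mult) (simp add: mono3_mult mult.assoc[symmetric])
    moreover have "vanishes_below 0 1 (mono3 0 1 0)"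
      by (simp add: vanishes_below_def coef3_mono3)
    ultimately show ?thesis
      using vanishes_below_mult[OF that(1) f(2)] vanishes_below_mult[OF _ that(2)]
      by (metis add.commute vanishes_below_add vanishes_below_mult_left)
  qed
  have nz: "A \<noteq> 0" "B \<noteq> 0" using lin by (simp_all add: A_def B_def)
  note step1 = solution_step[where p = 1 and q = 0, OF _ _ l nonresonant[OF a] c c'(1) nz(1)]
  note step2 = solution_step[where p = 0 and q = 1, OF _ _ l nonresonant[OF a] c c'(2) nz(2)]
  have ind: "vanishes_below 0 (s + 2) (f1 - const3 A * mono3 0 1 0) \<and>
      vanishes_below 0 (s + 2) (f2 - const3 B * mono3 0 0 1)" for s
  proof (induction s)
    case 0
    then show ?case using f1 f2 by (simp del: add_2_eq_Suc')
  next
    case (Suc s)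
    have "Suc s + 2 = (s + 2) + 1" by simp
    with Suc show ?case
      using step1(1)[of f1 "f1 * f2" "s + 2"] step2(1)[of f2 "f1 * f2" "s + 2"]
        W[of "s + 2"] eq1 eq2
      by (simp only: \<open>a1' = a1\<close> \<open>a2' = a2\<close>) simp
  qed
  have "fps_nth c1' n * (A * B) ^ n = fps_nth c1 n \<and> fps_nth c2' n * (A * B) ^ n = fps_nth c2 n" for n
  proof (cases n)
    case 0
    then show ?thesis by (simp add: c c')
  next
    case (Suc m)
    \<comment> \<open>The monomials y1 v^n and y2 v^n have degree 2 n + 1 in y1, y2, the order that
      \<open>ind\<close> provides at \<open>2 * m + 1\<close>.\<close>
    then have "2 * n + 1 = (2 * m + 1) + 2" by simp
    then show ?thesis
      using step1(2)[of f1 "f1 * f2" "2 * n + 1" "A * B" n]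
        step2(2)[of f2 "f1 * f2" "2 * n + 1" "A * B" n]
        W[of "2 * n + 1"] ind[of "2 * m + 1"] eq1 eq2 Suc
      by (simp add: \<open>a1' = a1\<close> \<open>a2' = a2\<close>)
  qed
  with nz \<open>a1' = a1\<close> \<open>a2' = a2\<close> show ?thesis by (intro that[of "A * B"]) auto
qed

section \<open>The linear part of a conjugacy and the necessity of equivalence\<close>

lemma Diff_linear_part:
  assumes "(var_x, f1, f2) \<in> Diff"
  shows "coef3 f1 0 1 0 * coef3 f2 0 0 1 - coef3 f1 0 0 1 * coef3 f2 0 1 0 \<noteq> 0"
proof -
  from assms obtain \<Psi> where origin: "fixes_origin (var_x, f1, f2)"
    and inv: "is_formal_inverse (var_x, f1, f2) \<Psi>" by (auto simp: Diff_def)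
  obtain g0 g1 g2 where \<Psi>: "\<Psi> = (g0, g1, g2)" by (cases \<Psi>)
  have "subst3 g1 (var_x, f1, f2) = var_y1" "subst3 g2 (var_x, f1, f2) = var_y2"
    using inv by (simp_all add: is_formal_inverse_def \<Psi> id3_def del: subst3.simps)
  then have "coef3 (subst3 g1 (var_x, f1, f2)) 0 j k = coef3 var_y1 0 j k"
    "coef3 (subst3 g2 (var_x, f1, f2)) 0 j k = coef3 var_y2 0 j k" for j k by simp_all
  \<comment> \<open>As the first component is \<open>var_x\<close>, the blocks of the linear parts
    in y1, y2 multiply to the identity, hence their determinants multiply to 1.\<close>
  from this[of 1 0] this[of 0 1]
  have "coef3 g1 0 1 0 * coef3 f1 0 1 0 + coef3 g1 0 0 1 * coef3 f2 0 1 0 = 1"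
    "coef3 g2 0 1 0 * coef3 f1 0 1 0 + coef3 g2 0 0 1 * coef3 f2 0 1 0 = 0"
    "coef3 g1 0 1 0 * coef3 f1 0 0 1 + coef3 g1 0 0 1 * coef3 f2 0 0 1 = 0"
    "coef3 g2 0 1 0 * coef3 f1 0 0 1 + coef3 g2 0 0 1 * coef3 f2 0 0 1 = 1"
    by (simp_all add: coef3_subst3_linear[OF origin] del: subst3.simps)
      (simp_all add: var_x_mono3 var_y1_mono3 var_y2_mono3 coef3_mono3)
  then have "(coef3 g1 0 1 0 * coef3 g2 0 0 1 - coef3 g1 0 0 1 * coef3 g2 0 1 0) *
      (coef3 f1 0 1 0 * coef3 f2 0 0 1 - coef3 f1 0 0 1 * coef3 f2 0 1 0) = 1"
    by algebra
  then show ?thesis by auto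
qed

lemma fps_compose_scale_inverse:
  fixes c c' :: "complex fps"
  assumes "t \<noteq> 0" "\<And>n. fps_nth c' n * t ^ n = fps_nth c n"
  shows "c' = fps_compose c (fps_const (inverse t) * fps_X)"
  unfolding fps_compose_linear
  using assms by (auto simp: fps_eq_iff field_simps power_inverse)

lemma fib_conjugate_imp_param_equiv:
  assumes conj: "fib_conjugate (normal_form (l, a1, a2, c1, c2)) (normal_form (l', a1', a2', c1', c2'))"
    and p: "(l, a1, a2, c1, c2) \<in> param_space" and p': "(l', a1', a2', c1', c2') \<in> param_space"
  shows "param_equiv (l, a1, a2, c1, c2) (l', a1', a2', c1', c2')"
proof -
  from conj obtain f1 f2 where \<Phi>: "(var_x, f1, f2) \<in> Diff"
    and "pushforward (var_x, f1, f2) (normal_form (l, a1, a2, c1, c2)) =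
      normal_form (l', a1', a2', c1', c2')"
    by (auto simp: fib_conjugate_def Diff_fib_def)
  then have eq1: "apply_vf (normal_form (l, a1, a2, c1, c2)) f1 =
      (const3 (- l') + const3 a1' * var_x + subst1 c1' (f1 * f2)) * f1"
    and eq2: "apply_vf (normal_form (l, a1, a2, c1, c2)) f2 =
      (const3 l' + const3 a2' * var_x + subst1 c2' (f1 * f2)) * f2"
    by (simp_all only: pushforward_normal_form_iff)
  from p p' have l: "l \<noteq> 0" "l' \<noteq> 0" and a: "(a1, a2) \<notin> Delta"
    and c: "fps_nth c1 0 = 0" "fps_nth c2 0 = 0" and c': "fps_nth c1' 0 = 0" "fps_nth c2' 0 = 0"
    by (auto simp: param_space_def)
  have f: "vanishes_below 0 1 f1" "vanishes_below 0 1 f2"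
    using solution_vanishes_on_x_axis[OF eq1 c c'(1)] solution_vanishes_on_x_axis[OF eq2 c c'(2)] l
    by auto
  note D = vanishes_below_subst1[OF c'(1) vanishes_below_mult_right[OF f(1), of f2]]
    vanishes_below_subst1[OF c'(2) vanishes_below_mult_right[OF f(1), of f2]]
  have lin: "(l * (of_nat k - of_nat j) + l') * coef3 f1 0 j k = 0"
    "(l * (of_nat k - of_nat j) - l') * coef3 f2 0 j k = 0" if "j + k = 1" for j k
    using coef3_solution[of l a1 a2 c1 c2 f1 "- l'" a1' _ 0 j k 0, OF _ c D(1)]
      coef3_solution[of l a1 a2 c1 c2 f2 l' a2' _ 0 j k 0, OF _ c D(2)] eq1 eq2 f that
    by simp_all
  have nz: "coef3 f1 0 1 0 * coef3 f2 0 0 1 - coef3 f1 0 0 1 * coef3 f2 0 1 0 \<noteq> 0"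
    by (rule Diff_linear_part[OF \<Phi>])
  \<comment> \<open>Otherwise every entry of the linear part in y1, y2 would vanish, contradicting
    \<open>nz\<close>.\<close>
  have "l' = l \<or> l' = - l"
    using lin[of 1 0] lin[of 0 1] nz by (auto simp: add_eq_0_iff)
  then show ?thesis
  proof
    assume l': "l' = l"
    then have "coef3 f1 0 1 0 \<noteq> 0" "coef3 f2 0 0 1 \<noteq> 0"
      using lin(1)[of 0 1] l nz by auto
    then obtain t where t: "t \<noteq> 0" "a1' = a1" "a2' = a2"
      "\<And>n. fps_nth c1' n * t ^ n = fps_nth c1 n" "\<And>n. fps_nth c2' n * t ^ n = fps_nth c2 n"
      using conjugacy_same_sign[OF eq1[unfolded l'] eq2[unfolded l'] l(1) a c c'] by blast
    \<comment> \<open>\<open>c'(t v) = c(v)\<close> means that \<open>c'\<close> is \<open>c\<close>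
      rescaled by the inverse of \<open>t\<close>.\<close>
    then have "(l', a1', a2', c1', c2') = param_act (inverse t, False) (l, a1, a2, c1, c2)"
      using fps_compose_scale_inverse[OF t(1)] l' by simp
    then show ?thesis using t(1) unfolding param_equiv_def param_orbit_def
      by (intro CollectI exI[of _ "inverse t"] exI[of _ False]) auto
  next
    assume l': "l' = - l"
    then have "coef3 f2 0 1 0 \<noteq> 0" "coef3 f1 0 0 1 \<noteq> 0"
      using lin(1)[of 1 0] l nz by auto
    \<comment> \<open>Exchanging the components reduces to the case of equal signs, since the
      product \<open>f1 * f2\<close> is symmetric.\<close>
    moreover have "apply_vf (normal_form (l, a1, a2, c1, c2)) f2 =
        (const3 (- l) + const3 a2' * var_x + subst1 c2' (f2 * f1)) * f2"
      "apply_vf (normal_form (l, a1, a2, c1, c2)) f1 =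
        (const3 l + const3 a1' * var_x + subst1 c1' (f2 * f1)) * f1"
      using eq1 eq2 by (simp_all only: l' mult.commute[of f2 f1] minus_minus)
    ultimately obtain t where t: "t \<noteq> 0" "a2' = a1" "a1' = a2"
      "\<And>n. fps_nth c2' n * t ^ n = fps_nth c1 n" "\<And>n. fps_nth c1' n * t ^ n = fps_nth c2 n"
      using conjugacy_same_sign[of l a1 a2 c1 c2 f2 a2' c2' f1 a1' c1'] l(1) a c c' by metis
    then have "(l', a1', a2', c1', c2') = param_act (inverse t, True) (l, a1, a2, c1, c2)"
      using fps_compose_scale_inverse[OF t(1)] l' by simp
    then show ?thesis using t(1) unfolding param_equiv_def param_orbit_def
      by (intro CollectI exI[of _ "inverse t"] exI[of _ True]) auto
  qed
qed

section \<open>Equivalent parameters\<close>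

lemma Diff_scale:
  assumes "t \<noteq> 0"
  shows "(var_x, const3 t * var_y1, var_y2) \<in> Diff" "(var_x, const3 t * var_y2, var_y1) \<in> Diff"
proof -
  have origin: "fixes_origin (var_x, const3 s * var_y1, var_y2)"
    "fixes_origin (var_x, const3 s * var_y2, var_y1)"
    "fixes_origin (var_x, var_y2, const3 s * var_y1)" for s
    by (simp_all add: var_x_mono3 var_y1_mono3 var_y2_mono3 coef3_mono3)
  have inv: "const3 t * (const3 (inverse t) * f) = f" "const3 (inverse t) * (const3 t * f) = f" for f
    using assms by (simp_all flip: mult.assoc const3_mult)
  have "is_formal_inverse (var_x, const3 t * var_y1, var_y2)
      (var_x, const3 (inverse t) * var_y1, var_y2)"
    "is_formal_inverse (var_x, const3 t * var_y2, var_y1)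
      (var_x, var_y2, const3 (inverse t) * var_y1)"
    unfolding is_formal_inverse_def using origin
    by (simp_all add: id3_def subst3_const_mult subst3_var[OF origin(1)] subst3_var[OF origin(2)]
        subst3_var[OF origin(3)] inv del: subst3.simps fixes_origin.simps)
  with origin show "(var_x, const3 t * var_y1, var_y2) \<in> Diff"
    "(var_x, const3 t * var_y2, var_y1) \<in> Diff" by (auto simp: Diff_def)
qed

text \<open>The components of the two maps used are monomials, hence multiplied by their cofactors,
  and their product is \<open>t v\<close> in both cases; the hypotheses say that
  \<open>c'(t v) = c(v)\<close>.\<close>

lemma fib_conjugate_scale:
  assumes t: "t \<noteq> 0"
    and c1: "\<And>n. fps_nth c1' n * t ^ n = fps_nth c1 n"
    and c2: "\<And>n. fps_nth c2' n * t ^ n = fps_nth c2 n"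
  shows "fib_conjugate (normal_form (l, a1, a2, c1, c2)) (normal_form (l, a1, a2, c1', c2'))"
    and "fib_conjugate (normal_form (l, a1, a2, c1, c2)) (normal_form (- l, a2, a1, c2', c1'))"
proof -
  have c: "subst1 c' (const3 t * mono3 0 1 1) = subst1 c (mono3 0 1 1)"
    if "\<And>n. fps_nth c' n * t ^ n = fps_nth c n" for c c'
    using coef3_subst1_monomial[of c' t] coef3_subst1_monomial[of c 1] that
    by (intro fps3_eqI) simp
  note mono = apply_normal_form_monomial[of l a1 a2 c1 c2 t 1 0]
    apply_normal_form_monomial[of l a1 a2 c1 c2 t 0 1]
    apply_normal_form_monomial[of l a1 a2 c1 c2 1 1 0]
    apply_normal_form_monomial[of l a1 a2 c1 c2 1 0 1]
  have v: "const3 t * mono3 0 1 0 * mono3 0 0 1 = const3 t * mono3 0 1 1"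
    "const3 t * mono3 0 0 1 * mono3 0 1 0 = const3 t * mono3 0 1 1"
    by (simp_all add: mult.assoc mono3_mult)
  have "pushforward (var_x, const3 t * var_y1, var_y2) (normal_form (l, a1, a2, c1, c2)) =
      normal_form (l, a1, a2, c1', c2')"
    unfolding pushforward_normal_form_iff[OF Diff_scale(1)[OF t]]
    using mono by (simp add: var_y1_mono3 var_y2_mono3 v c[OF c1] c[OF c2]
      del: apply_vf.simps normal_form.simps)
  then show "fib_conjugate (normal_form (l, a1, a2, c1, c2)) (normal_form (l, a1, a2, c1', c2'))"
    unfolding fib_conjugate_def Diff_fib_def using Diff_scale(1)[OF t] by auto
  have "pushforward (var_x, const3 t * var_y2, var_y1) (normal_form (l, a1, a2, c1, c2)) =
      normal_form (- l, a2, a1, c2', c1')"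
    unfolding pushforward_normal_form_iff[OF Diff_scale(2)[OF t]]
    using mono by (simp add: var_y1_mono3 var_y2_mono3 v c[OF c1] c[OF c2]
      del: apply_vf.simps normal_form.simps)
  then show "fib_conjugate (normal_form (l, a1, a2, c1, c2)) (normal_form (- l, a2, a1, c2', c1'))"
    unfolding fib_conjugate_def Diff_fib_def using Diff_scale(2)[OF t] by auto
qed

lemma param_equiv_imp_fib_conjugate:
  assumes "param_equiv (l, a1, a2, c1, c2) p'"
  shows "fib_conjugate (normal_form (l, a1, a2, c1, c2)) (normal_form p')"
proof -
  from assms obtain \<theta> s where \<theta>: "\<theta> \<noteq> 0" and p': "p' = param_act (\<theta>, s) (l, a1, a2, c1, c2)"
    by (auto simp: param_equiv_def param_orbit_def)
  \<comment> \<open>The action of \<open>\<theta>\<close> is realised by the linear map with factor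
    \<open>inverse \<theta>\<close>.\<close>
  have "fps_nth (fps_compose c (fps_const \<theta> * fps_X)) n * inverse \<theta> ^ n = fps_nth c n"
    for c :: "complex fps" and n
    using \<theta> by (simp add: fps_compose_linear power_inverse)
  note conj = fib_conjugate_scale[OF _ this this]
  show ?thesis using conj[of l a1 a2] \<theta> by (cases s) (simp_all add: p' del: normal_form.simps)
qed

theorem theorem1p6:
  fixes l a1 a2 l' a1' a2' :: complex and c1 c2 c1' c2' :: "complex fps"
  assumes "(l, a1, a2, c1, c2) \<in> param_space"
    and "(l', a1', a2', c1', c2') \<in> param_space"
  shows "fib_conjugate (normal_form (l, a1, a2, c1, c2)) (normal_form (l', a1', a2', c1', c2'))
     \<longleftrightarrow> param_equiv (l, a1, a2, c1, c2) (l', a1', a2', c1', c2')"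
  using fib_conjugate_imp_param_equiv[OF _ assms] param_equiv_imp_fib_conjugate by blast

end
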